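(* Let $H$ be a multigraph and let $k \geq |E(H)|$ be an integer. Then the limit $$\pi^{\ast}_k(H)=\lim_{n \rightarrow \infty} \frac{\mathrm{ex}_k^{\ast}(n, H)}{{n \choose 2}}$$ exists.
   Context: All multigraphs have no loops (parallel edges allowed). A graph system of order $k$ on a vertex set $V$ is a tuple $\mathcal{G}=(G_1,\dots,G_k)$ of simple graphs on the common vertex set $V$. A multigraph $H$ with $V(H)\subseteq V$ is a rainbow subgraph of $\mathcal{G}$ if there is an injective map $\psi:E(H)\to[k]$ with $e\in E(G_{\psi(e)})$ for every $e\in E(H)$; $\mathcal{G}$ is rainbow $H$-free if it has no rainbow subgraph isomorphic to $H$. The rainbow extremal number $\mathrm{ex}_k^{\ast}(n,H)$ is the maximum of $\min_{1\le i\le k}|E(G_i)|$ over all rainbow $H$-free graph systems $(G_1,\dots,G_k)$ of order $k$ on $[n]$. *)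

theory Defs
  imports Complex_Main "HOL-Library.Ramsey"
begin

text \<open>
  A multigraph carries an abstract set of edges together with the pair of end vertices of each
  edge, so parallel edges are distinct elements of \<open>mg_edges\<close> with the same \<open>mg_ends\<close>.
  Graphs are finite; requiring exactly two ends per edge excludes loops.
\<close>

record ('v, 'e) multigraph =
  mg_verts :: "'v set"
  mg_edges :: "'e set"
  mg_ends :: "'e \<Rightarrow> 'v set"

definition is_multigraph :: "('v, 'e) multigraph \<Rightarrow> bool" where
  "is_multigraph H \<longleftrightarrow>
     finite (mg_verts H) \<and> finite (mg_edges H) \<and> mg_ends H ` mg_edges H \<subseteq> nsets (mg_verts H) 2"

definition mg_isomorphic :: "('v, 'e) multigraph \<Rightarrow> ('w, 'f) multigraph \<Rightarrow> bool" where
  "mg_isomorphic H H' \<longleftrightarrow>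
     (\<exists>f g. bij_betw f (mg_verts H) (mg_verts H') \<and> bij_betw g (mg_edges H) (mg_edges H') \<and>
        (\<forall>e \<in> mg_edges H. mg_ends H' (g e) = f ` mg_ends H e))"

text \<open>
  A simple graph on a fixed vertex set \<open>V\<close> is given by its edge set, a set of 2-element subsets
  of \<open>V\<close>. In a graph system of order \<open>k\<close> only the members with index in \<open>{1..k}\<close> matter.
\<close>

definition graph_system :: "nat \<Rightarrow> 'v set \<Rightarrow> (nat \<Rightarrow> 'v set set) \<Rightarrow> bool" where
  "graph_system k V G \<longleftrightarrow> (\<forall>i \<in> {1..k}. G i \<subseteq> nsets V 2)"

definition rainbow_subgraph ::
    "nat \<Rightarrow> 'v set \<Rightarrow> (nat \<Rightarrow> 'v set set) \<Rightarrow> ('v, 'e) multigraph \<Rightarrow> bool" where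
  "rainbow_subgraph k V G H \<longleftrightarrow>
     is_multigraph H \<and> mg_verts H \<subseteq> V \<and>
     (\<exists>\<psi>. inj_on \<psi> (mg_edges H) \<and> \<psi> ` mg_edges H \<subseteq> {1..k} \<and>
        (\<forall>e \<in> mg_edges H. mg_ends H e \<in> G (\<psi> e)))"

text \<open>
  The copy \<open>H'\<close> of \<open>H\<close> may be taken with edges of the same type as those of \<open>H\<close>, since edges of a
  multigraph are only labels.
\<close>

definition rainbow_free ::
    "nat \<Rightarrow> 'v set \<Rightarrow> (nat \<Rightarrow> 'v set set) \<Rightarrow> ('w, 'e) multigraph \<Rightarrow> bool" where
  "rainbow_free k V G H \<longleftrightarrow>
     \<not> (\<exists>H' :: ('v, 'e) multigraph. rainbow_subgraph k V G H' \<and> mg_isomorphic H H')"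

definition rainbow_ex_values :: "nat \<Rightarrow> nat \<Rightarrow> ('w, 'e) multigraph \<Rightarrow> nat set" where
  "rainbow_ex_values k n H =
     {Min ((\<lambda>i. card (G i)) ` {1..k}) | G. graph_system k {1..n} G \<and> rainbow_free k {1..n} G H}"

definition rainbow_ex :: "nat \<Rightarrow> nat \<Rightarrow> ('w, 'e) multigraph \<Rightarrow> nat" where
  "rainbow_ex k n H = Max (rainbow_ex_values k n H)"

text \<open>
  The maximum is over a finite set, which is nonempty as soon as \<open>H\<close> has an edge. For edgeless \<open>H\<close>
  and \<open>n \<ge> card (mg_verts H)\<close> no system is rainbow \<open>H\<close>-free, and \<open>rainbow_ex k n H\<close> is then the
  unspecified constant \<open>Max {}\<close>, which does not depend on \<open>n\<close>.
\<close>

lemma finite_rainbow_ex_values: "finite (rainbow_ex_values k n H)"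
proof (cases "k = 0")
  case True
  have "rainbow_ex_values k n H \<subseteq> {Min {}}"
    using True by (auto simp: rainbow_ex_values_def)
  then show ?thesis by (rule finite_subset) simp
next
  case False
  have "Min ((\<lambda>i. card (G i)) ` {1..k}) \<le> card (nsets {1..n} 2)"
    if G: "graph_system k {1..n} G" for G :: "nat \<Rightarrow> nat set set"
  proof -
    have "Min ((\<lambda>i. card (G i)) ` {1..k}) \<le> card (G 1)"
      using False by (intro Min_le) auto
    also have "\<dots> \<le> card (nsets {1..n} 2)"
      using G False by (intro card_mono) (auto simp: graph_system_def intro: finite_imp_finite_nsets)
    finally show ?thesis .
  qed
  then have "rainbow_ex_values k n H \<subseteq> {..card (nsets {1..n} 2)}"
    by (auto simp: rainbow_ex_values_def)
  then show ?thesis by (rule finite_subset) simp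
qed

lemma rainbow_ex_values_nonempty:
  assumes "mg_edges H \<noteq> {}"
  shows "rainbow_ex_values k n H \<noteq> {}"
proof -
  have "rainbow_free k {1..n} (\<lambda>_. {}) H"
    using assms by (auto simp: rainbow_free_def rainbow_subgraph_def mg_isomorphic_def bij_betw_def)
  moreover have "graph_system k {1..n} (\<lambda>_. {})"
    by (simp add: graph_system_def)
  ultimately show ?thesis
    unfolding rainbow_ex_values_def by blast
qed

end

theory Submission
  imports Defs "HOL-Real_Asymp.Real_Asymp"
begin

text \<open>
  Deleting a vertex that is good for one \<open>G i\<close> may be bad for another, so the usual vertex-averaging
  argument does not show that the densities decrease. Instead, restrict an extremal system on
  \<open>N\<close> vertices to a random set of \<open>m \<le> N\<close> vertices. Two disjoint edges are negatively
  correlated, hence the number of edges of each \<open>G i\<close> inside the random set has variance at most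
  \<open>m ^ 3\<close>, and some set is within \<open>sqrt (k * m ^ 3)\<close> of the mean for all \<open>k\<close> graphs at once.
  The densities \<open>a n\<close> therefore satisfy \<open>a N \<le> a m + o(1)\<close> for \<open>m \<le> N\<close>, with an error that depends
  only on \<open>m\<close>, and such a sequence converges.
\<close>

section \<open>Counting m-subsets and comparing binomial ratios\<close>

text \<open>Removing \<open>T\<close> turns the \<open>m\<close>-sets containing it into subsets of
  \<open>V - T\<close> of size \<open>m - card T\<close>, and the subset-of-a-subset identity for
  binomials does the rest. In probabilistic terms, a uniform \<open>m\<close>-set contains a fixed
  \<open>t\<close>-set with probability (m choose t) / (|V| choose t); the product form avoids
  division.\<close>

lemma card_nsets_supersets:
  assumes "finite V" "T \<subseteq> V" "m \<le> card V"
  shows "card {S \<in> nsets V m. T \<subseteq> S} * (card V choose card T) =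
         (card V choose m) * (m choose card T)"
proof (cases "card T \<le> m")
  case True
  have fT: "finite T" using assms finite_subset by blast
  have "bij_betw (\<lambda>A. A \<union> T) (nsets (V - T) (m - card T)) {S \<in> nsets V m. T \<subseteq> S}"
  proof (rule bij_betwI[where g = "\<lambda>S. S - T"])
    show "(\<lambda>A. A \<union> T) \<in> nsets (V - T) (m - card T) \<rightarrow> {S \<in> nsets V m. T \<subseteq> S}"
    proof
      fix A assume A: "A \<in> nsets (V - T) (m - card T)"
      then have "finite A" "A \<inter> T = {}" "A \<subseteq> V" "card A = m - card T"
        by (auto simp: nsets_def)
      then show "A \<union> T \<in> {S \<in> nsets V m. T \<subseteq> S}"
        using fT True assms by (auto simp: nsets_def card_Un_disjoint)
    qed
    show "(\<lambda>S. S - T) \<in> {S \<in> nsets V m. T \<subseteq> S} \<rightarrow> nsets (V - T) (m - card T)"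
      using fT by (auto simp: nsets_def card_Diff_subset)
  qed (auto simp: nsets_def)
  then have "card {S \<in> nsets V m. T \<subseteq> S} = (card V - card T) choose (m - card T)"
    using assms fT by (simp flip: bij_betw_same_card add: card_Diff_subset)
  then show ?thesis
    using choose_mult[OF True assms(3)] by (simp add: mult.commute)
next
  case False
  have empty: "{S \<in> nsets V m. T \<subseteq> S} = {}"
    using False card_mono by (auto simp: nsets_def)
  have "m choose card T = 0" using False by (simp add: binomial_eq_0)
  then show ?thesis unfolding empty by simp
qed

lemma of_nat_choose_two: "real (n choose 2) = real n * (real n - 1) / 2"
  by (induction n) (auto simp: numeral_2_eq_2 field_simps)

text \<open>Factor by factor: (m-2)/m \<le> (N-2)/N and (m-3)/(m-1) \<le> (N-3)/(N-1), both
  cross-multiplied. The bound \<open>4 \<le> m\<close> keeps the natural subtractions exact and the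
  factors nonnegative, so that the two inequalities can be multiplied.\<close>

lemma choose_two_ratio_mono:
  assumes "4 \<le> m" "m \<le> N"
  shows "real ((m - 2) choose 2) * real (N choose 2) \<le> real (m choose 2) * real ((N - 2) choose 2)"
proof -
  have 1: "real (m - 2) * real N \<le> real m * real (N - 2)"
    using assms by (simp add: of_nat_diff algebra_simps)
  have 2: "(real (m - 2) - 1) * (real N - 1) \<le> (real m - 1) * (real (N - 2) - 1)"
    using assms by (simp add: of_nat_diff algebra_simps)
  have 3: "0 \<le> (real (m - 2) - 1) * (real N - 1)"
    using assms by (intro mult_nonneg_nonneg) (auto simp: of_nat_diff)
  have "(real (m - 2) * real N) * ((real (m - 2) - 1) * (real N - 1)) \<le>
      (real m * real (N - 2)) * ((real m - 1) * (real (N - 2) - 1))"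
    by (rule mult_mono[OF 1 2 _ 3]) simp
  then show ?thesis
    by (simp add: of_nat_choose_two field_simps)
qed

text \<open>This is the negative correlation: the left side is the probability that a random
  \<open>m\<close>-set contains two given disjoint edges, the right side the square of the
  probability for one edge. Choosing four points as two pairs in succession splits both binomials
  and leaves the comparison of ratios above.\<close>

lemma choose_four_ratio_le:
  assumes "m \<le> N" "4 \<le> N"
  shows "real (m choose 4) / real (N choose 4) \<le> (real (m choose 2) / real (N choose 2))\<^sup>2"
proof (cases "4 \<le> m")
  case True
  have split: "real (n choose 4) = real (n choose 2) * real ((n - 2) choose 2) / 6" if "4 \<le> n" for n
  proof -
    have "(n choose 4) * (4 choose 2) = (n choose 2) * ((n - 2) choose (4 - 2))"
      using that by (intro choose_mult) auto
    then have "(n choose 4) * 6 = (n choose 2) * ((n - 2) choose 2)"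
      by (simp add: choose_two)
    then have "real ((n choose 4) * 6) = real ((n choose 2) * ((n - 2) choose 2))"
      by (simp only:)
    then show ?thesis by simp
  qed
  have pos: "real (N choose 2) > 0" "real ((N - 2) choose 2) > 0"
    using assms by (simp_all add: zero_less_binomial)
  have "real ((m - 2) choose 2) / real ((N - 2) choose 2) \<le> real (m choose 2) / real (N choose 2)"
    using choose_two_ratio_mono[OF True assms(1)] pos by (simp add: field_simps)
  then have "real (m choose 2) / real (N choose 2) * (real ((m - 2) choose 2) / real ((N - 2) choose 2))
      \<le> real (m choose 2) / real (N choose 2) * (real (m choose 2) / real (N choose 2))"
    by (intro mult_left_mono) auto
  then show ?thesis
    unfolding split[OF True] split[OF assms(2)] by (simp add: power2_eq_square)
qed (simp add: binomial_eq_0)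

section \<open>Mean and variance of the number of edges in a random m-set\<close>

text \<open>Such a pair is given by one of at most two points of \<open>e\<close> and a further
  point of \<open>S\<close>.\<close>

lemma card_pairs_meeting_le:
  assumes "finite S" "card e \<le> 2" "finite e"
  shows "card {f \<in> nsets S 2. f \<inter> e \<noteq> {}} \<le> 2 * card S"
proof -
  have "{f \<in> nsets S 2. f \<inter> e \<noteq> {}} \<subseteq> (\<lambda>(x, z). {x, z}) ` (e \<times> S)"
  proof
    fix f assume f: "f \<in> {f \<in> nsets S 2. f \<inter> e \<noteq> {}}"
    then obtain x where "x \<in> f" "x \<in> e" by blast
    moreover obtain a b where "f = {a, b}" "a \<in> S" "b \<in> S"
      using f by (auto simp: nsets_def card_2_iff)
    ultimately have "f = {x, a} \<and> a \<in> S \<or> f = {x, b} \<and> b \<in> S" by auto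
    then show "f \<in> (\<lambda>(x, z). {x, z}) ` (e \<times> S)"
      using \<open>x \<in> e\<close> by blast
  qed
  then have "card {f \<in> nsets S 2. f \<inter> e \<noteq> {}} \<le> card (e \<times> S)"
    using assms by (intro surj_card_le[where f = "\<lambda>(x, z). {x, z}"]) simp_all
  also have "\<dots> \<le> 2 * card S"
    using assms by (simp add: card_cartesian_product)
  finally show ?thesis .
qed

text \<open>First moment, by double counting the incidences between edges and \<open>m\<close>-sets.
  Expectations are written throughout as sums over \<open>nsets V m\<close>, with the factor
  \<open>card (nsets V m)\<close> kept on the right.\<close>

lemma sum_card_edges_within:
  fixes G :: "'a set set"
  assumes "finite V" "G \<subseteq> nsets V 2" "m \<le> card V" "2 \<le> card V"
  defines "p \<equiv> real (m choose 2) / real (card V choose 2)"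
  shows "(\<Sum>S\<in>nsets V m. real (card {e \<in> G. e \<subseteq> S})) = real (card G) * p * real (card (nsets V m))"
proof -
  have fin: "finite G" "finite (nsets V m)"
    using assms by (auto intro: finite_subset finite_imp_finite_nsets)
  have pos: "real (card V choose 2) > 0"
    using assms by (simp add: zero_less_binomial)
  have count: "real (card {S \<in> nsets V m. e \<subseteq> S}) = p * real (card (nsets V m))" if "e \<in> G" for e
  proof -
    have e: "e \<subseteq> V" "card e = 2" using that assms by (auto simp: nsets_def)
    have "real (card {S \<in> nsets V m. e \<subseteq> S} * (card V choose 2)) =
        real ((card V choose m) * (m choose 2))"
      using card_nsets_supersets[OF assms(1) e(1) assms(3)] e(2) by simp
    then show ?thesis using pos by (simp add: p_def field_simps)
  qed
  have "(\<Sum>S\<in>nsets V m. card {e \<in> G. e \<subseteq> S}) = (\<Sum>e\<in>G. card {S \<in> nsets V m. e \<subseteq> S})"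
    using fin by (intro sum_multicount_gen) auto
  then have "(\<Sum>S\<in>nsets V m. real (card {e \<in> G. e \<subseteq> S})) = (\<Sum>e\<in>G. real (card {S \<in> nsets V m. e \<subseteq> S}))"
    by (simp only: flip: of_nat_sum)
  also have "\<dots> = (\<Sum>e\<in>G. p * real (card (nsets V m)))"
    using count by (intro sum.cong) auto
  finally show ?thesis by simp
qed

text \<open>Disjoint part of the second moment: there are at most \<open>(card G)\<^sup>2\<close>
  ordered pairs, and by negative correlation each lies inside a random \<open>m\<close>-set with
  probability at most \<open>p\<^sup>2\<close>.\<close>

lemma sum_card_disjoint_edge_pairs_within_le:
  fixes G :: "'a set set"
  assumes "finite V" "G \<subseteq> nsets V 2" "m \<le> card V"
  defines "p \<equiv> real (m choose 2) / real (card V choose 2)"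
  shows "(\<Sum>S\<in>nsets V m. real (card {(e, f) \<in> G \<times> G. e \<inter> f = {} \<and> e \<union> f \<subseteq> S}))
    \<le> (real (card G) * p)\<^sup>2 * real (card (nsets V m))"
proof -
  define P where "P = {(e, f) \<in> G \<times> G. e \<inter> f = {}}"
  have finG: "finite G" using assms by (auto intro: finite_subset finite_imp_finite_nsets)
  have fin: "finite P" "finite (nsets V m)"
    using assms finG by (auto simp: P_def intro: finite_imp_finite_nsets finite_subset[of _ "G \<times> G"])
  have count: "real (card {S \<in> nsets V m. fst q \<union> snd q \<subseteq> S}) \<le> p\<^sup>2 * real (card (nsets V m))"
    if "q \<in> P" for q
  proof -
    obtain e f where q: "q = (e, f)" "e \<in> G" "f \<in> G" "e \<inter> f = {}"
      using \<open>q \<in> P\<close> by (auto simp: P_def)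
    have "e \<in> nsets V 2" "f \<in> nsets V 2" using q assms(2) by auto
    then have ef: "e \<union> f \<subseteq> V" "card (e \<union> f) = 4"
      using q(4) by (auto simp: nsets_def card_Un_disjoint)
    then have N: "4 \<le> card V" using assms card_mono by metis
    then have pos: "real (card V choose 4) > 0" by (simp add: zero_less_binomial)
    have "real (card {S \<in> nsets V m. e \<union> f \<subseteq> S} * (card V choose 4)) =
        real ((card V choose m) * (m choose 4))"
      using card_nsets_supersets[OF assms(1) ef(1) assms(3)] unfolding ef(2) by (simp only:)
    then have "real (card {S \<in> nsets V m. e \<union> f \<subseteq> S}) =
        real (m choose 4) / real (card V choose 4) * real (card (nsets V m))"
      using pos by (simp add: field_simps)
    also have "\<dots> \<le> p\<^sup>2 * real (card (nsets V m))"
      unfolding p_def using choose_four_ratio_le[OF assms(3) N] by (intro mult_right_mono) auto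
    finally show ?thesis by (simp add: q)
  qed
  have "{(e, f) \<in> G \<times> G. e \<inter> f = {} \<and> e \<union> f \<subseteq> S} = {q \<in> P. fst q \<union> snd q \<subseteq> S}" for S
    by (auto simp: P_def)
  then have "(\<Sum>S\<in>nsets V m. card {(e, f) \<in> G \<times> G. e \<inter> f = {} \<and> e \<union> f \<subseteq> S}) =
      (\<Sum>S\<in>nsets V m. card {q \<in> P. fst q \<union> snd q \<subseteq> S})"
    by simp
  also have "\<dots> = (\<Sum>q\<in>P. card {S \<in> nsets V m. fst q \<union> snd q \<subseteq> S})"
    using fin by (intro sum_multicount_gen) auto
  finally have "(\<Sum>S\<in>nsets V m. real (card {(e, f) \<in> G \<times> G. e \<inter> f = {} \<and> e \<union> f \<subseteq> S})) =
      (\<Sum>q\<in>P. real (card {S \<in> nsets V m. fst q \<union> snd q \<subseteq> S}))"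
    by (simp only: flip: of_nat_sum)
  also have "\<dots> \<le> real (card P) * (p\<^sup>2 * real (card (nsets V m)))"
    using count by (intro sum_bounded_above) auto
  also have "\<dots> \<le> real (card (G \<times> G)) * (p\<^sup>2 * real (card (nsets V m)))"
    using finG by (intro mult_right_mono of_nat_mono card_mono) (auto simp: P_def)
  finally show ?thesis by (simp add: power2_eq_square algebra_simps card_cartesian_product)
qed

text \<open>The square counts ordered pairs of edges inside \<open>S\<close>. Pairs that are not
  disjoint, including those with \<open>e = f\<close>, number at most \<open>2 * card S\<close> for
  each first edge \<open>e\<close>.\<close>

lemma card_edges_within_sq_le:
  assumes "finite S" "finite G" "\<And>e. e \<in> G \<Longrightarrow> card e = 2"
  shows "(card {e \<in> G. e \<subseteq> S})\<^sup>2 \<le>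
    card {(e, f) \<in> G \<times> G. e \<inter> f = {} \<and> e \<union> f \<subseteq> S} + 2 * card S * card {e \<in> G. e \<subseteq> S}"
proof -
  define E where "E = {e \<in> G. e \<subseteq> S}"
  \<comment> \<open>\<open>F e\<close> takes all pairs of \<open>S\<close> that meet
    \<open>e\<close>, whether or not they lie in \<open>G\<close>, so its size is bounded
    independently of \<open>G\<close>.\<close>
  define F where "F e = {f \<in> nsets S 2. f \<inter> e \<noteq> {}}" for e
  define D where "D = {(e, f) \<in> G \<times> G. e \<inter> f = {} \<and> e \<union> f \<subseteq> S}"
  have E: "e \<subseteq> S" "finite e" "card e = 2" if "e \<in> E" for e
    using that assms(3) finite_subset[OF _ assms(1)] unfolding E_def by blast+
  have finE: "finite E" unfolding E_def using assms(2) by simp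
  have finD: "finite D"
    by (rule finite_subset[OF _ finite_cartesian_product[OF assms(2) assms(2)]]) (auto simp: D_def)
  have finF: "finite (F e)" for e
    by (rule finite_subset[OF _ finite_imp_finite_nsets[OF assms(1), of 2]]) (auto simp: F_def)
  have "E \<times> E \<subseteq> D \<union> Sigma E F"
  proof
    fix q assume "q \<in> E \<times> E"
    then obtain e f where q: "q = (e, f)" "e \<in> E" "f \<in> E" by blast
    then have "f \<in> nsets S 2" using E[of f] by (simp add: nsets_def)
    moreover have "(e, f) \<in> D" if "e \<inter> f = {}"
      using q that by (simp add: D_def E_def)
    ultimately show "q \<in> D \<union> Sigma E F"
      using q by (cases "e \<inter> f = {}") (simp_all add: F_def Int_commute)
  qed
  then have "card (E \<times> E) \<le> card (D \<union> Sigma E F)"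
    using finD finE finF by (intro card_mono finite_UnI finite_SigmaI)
  also have "\<dots> \<le> card D + card (Sigma E F)"
    by (rule card_Un_le)
  also have "card (Sigma E F) = (\<Sum>e\<in>E. card (F e))"
    using finE finF by (intro card_SigmaI) auto
  also have "\<dots> \<le> (\<Sum>e\<in>E. 2 * card S)"
    unfolding F_def using assms(1) E by (intro sum_mono card_pairs_meeting_le) simp_all
  finally have "(card E)\<^sup>2 \<le> card D + 2 * card S * card E"
    by (simp add: power2_eq_square card_cartesian_product mult.commute)
  then show ?thesis unfolding E_def D_def .
qed

lemma variance_card_edges_within_le:
  fixes G :: "'a set set"
  assumes "finite V" "G \<subseteq> nsets V 2" "m \<le> card V" "2 \<le> card V"
  defines "\<mu> \<equiv> real (card G) * (real (m choose 2) / real (card V choose 2))"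
  shows "(\<Sum>S\<in>nsets V m. (real (card {e \<in> G. e \<subseteq> S}) - \<mu>)\<^sup>2) \<le> real m ^ 3 * real (card (nsets V m))"
proof -
  let ?D = "nsets V m"
  let ?X = "\<lambda>S. real (card {e \<in> G. e \<subseteq> S})"
  have finG: "finite G" using assms by (auto intro: finite_subset finite_imp_finite_nsets)
  have mean: "(\<Sum>S\<in>?D. ?X S) = \<mu> * real (card ?D)"
    using sum_card_edges_within[OF assms(1-4)] unfolding \<mu>_def by simp
  have "(\<Sum>S\<in>?D. (?X S)\<^sup>2) \<le> (\<Sum>S\<in>?D.
      real (card {(e, f) \<in> G \<times> G. e \<inter> f = {} \<and> e \<union> f \<subseteq> S}) + 2 * real m * ?X S)"
  proof (rule sum_mono)
    fix S assume "S \<in> ?D"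
    then have S: "finite S" "card S = m" by (auto simp: nsets_def)
    have "(card {e \<in> G. e \<subseteq> S})\<^sup>2 \<le>
        card {(e, f) \<in> G \<times> G. e \<inter> f = {} \<and> e \<union> f \<subseteq> S} + 2 * m * card {e \<in> G. e \<subseteq> S}"
      using card_edges_within_sq_le[OF S(1) finG] assms(2) S(2) by (auto simp: nsets_def)
    then have "real ((card {e \<in> G. e \<subseteq> S})\<^sup>2) \<le> real
        (card {(e, f) \<in> G \<times> G. e \<inter> f = {} \<and> e \<union> f \<subseteq> S} + 2 * m * card {e \<in> G. e \<subseteq> S})"
      by (simp only: of_nat_le_iff)
    then show "(?X S)\<^sup>2 \<le>
        real (card {(e, f) \<in> G \<times> G. e \<inter> f = {} \<and> e \<union> f \<subseteq> S}) + 2 * real m * ?X S"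
      by simp
  qed
  also have "\<dots> \<le> \<mu>\<^sup>2 * real (card ?D) + 2 * real m * (\<mu> * real (card ?D))"
    using sum_card_disjoint_edge_pairs_within_le[OF assms(1-3)]
    by (simp add: sum.distrib mean \<mu>_def flip: sum_distrib_left)
  finally have second: "(\<Sum>S\<in>?D. (?X S)\<^sup>2) \<le>
      \<mu>\<^sup>2 * real (card ?D) + 2 * real m * (\<mu> * real (card ?D))" .
  have "(\<Sum>S\<in>?D. (?X S - \<mu>)\<^sup>2) = (\<Sum>S\<in>?D. (?X S)\<^sup>2) - 2 * \<mu> * (\<Sum>S\<in>?D. ?X S) + \<mu>\<^sup>2 * real (card ?D)"
    by (simp add: power2_diff sum.distrib sum_subtractf sum_distrib_left algebra_simps)
  \<comment> \<open>The \<open>\<mu>\<^sup>2\<close> terms cancel: disjoint pairs contribute at most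
    \<open>\<mu>\<^sup>2\<close> to the second moment, so only the term from meeting pairs
    survives.\<close>
  also have "\<dots> \<le> 2 * real m * \<mu> * real (card ?D)"
    using second unfolding mean by (simp add: power2_eq_square algebra_simps)
  also have "\<dots> \<le> real m ^ 3 * real (card ?D)"
  proof (rule mult_right_mono)
    \<comment> \<open>Since \<open>G\<close> has density at most 1, \<open>\<mu>\<close> is at most
      (m choose 2), which is at most m^2 / 2.\<close>
    have "card G \<le> card V choose 2"
      using assms card_mono[OF finite_imp_finite_nsets] by (metis card_nsets)
    then have "real (card G) / real (card V choose 2) \<le> 1"
      using assms(4) by (simp add: divide_le_eq_1 not_less)
    then have "real (m choose 2) * (real (card G) / real (card V choose 2)) \<le> real (m choose 2) * 1"
      by (intro mult_left_mono) auto
    then have "\<mu> \<le> real (m choose 2)" by (simp add: \<mu>_def mult.commute)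
    then have "2 * \<mu> \<le> real m * (real m - 1)" by (simp add: of_nat_choose_two)
    also have "\<dots> \<le> real m * real m" by (intro mult_left_mono) auto
    finally have "real m * (2 * \<mu>) \<le> real m * (real m * real m)" by (intro mult_left_mono) auto
    then show "2 * real m * \<mu> \<le> real m ^ 3" by (simp add: power3_eq_cube algebra_simps)
  qed simp
  finally show ?thesis .
qed

section \<open>One set that serves all k graphs\<close>

text \<open>The squared deviations of all \<open>k\<close> graphs are added before averaging. Their
  sum has mean at most k * m^3, so some \<open>S\<close> attains this bound, and there each single
  squared deviation is bounded by the whole sum.\<close>

lemma graph_system_dense_subset:
  assumes "finite V" "graph_system k V G" "m \<le> card V" "2 \<le> card V"
  obtains S where "S \<in> nsets V m"
    "\<And>i. i \<in> {1..k} \<Longrightarrow>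
      real (card (G i)) * (real (m choose 2) / real (card V choose 2)) - sqrt (real k * real m ^ 3)
        \<le> real (card {e \<in> G i. e \<subseteq> S})"
proof -
  define \<mu> where "\<mu> i = real (card (G i)) * (real (m choose 2) / real (card V choose 2))" for i
  define Y where "Y i S = (real (card {e \<in> G i. e \<subseteq> S}) - \<mu> i)\<^sup>2" for i S
  have D: "finite (nsets V m)" "nsets V m \<noteq> {}"
    using assms by (auto intro: finite_imp_finite_nsets simp: nsets_eq_empty_iff)
  have "(\<Sum>S\<in>nsets V m. \<Sum>i\<in>{1..k}. Y i S) = (\<Sum>i\<in>{1..k}. \<Sum>S\<in>nsets V m. Y i S)"
    by (rule sum.swap)
  also have "\<dots> \<le> (\<Sum>i\<in>{1..k}. real m ^ 3 * real (card (nsets V m)))"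
    using assms unfolding Y_def \<mu>_def
    by (intro sum_mono variance_card_edges_within_le) (auto simp: graph_system_def)
  also have "\<dots> = (\<Sum>S\<in>nsets V m. real k * real m ^ 3)"
    by simp
  finally have total: "(\<Sum>S\<in>nsets V m. \<Sum>i\<in>{1..k}. Y i S) \<le> (\<Sum>S\<in>nsets V m. real k * real m ^ 3)" .
  have "\<exists>S\<in>nsets V m. (\<Sum>i\<in>{1..k}. Y i S) \<le> real k * real m ^ 3"
  proof (rule ccontr)
    assume "\<not> ?thesis"
    then have "(\<Sum>S\<in>nsets V m. real k * real m ^ 3) < (\<Sum>S\<in>nsets V m. \<Sum>i\<in>{1..k}. Y i S)"
      by (intro sum_strict_mono D) (simp only: bex_simps ball_simps not_le)
    with total show False by linarith
  qed
  then obtain S where S: "S \<in> nsets V m" "(\<Sum>i\<in>{1..k}. Y i S) \<le> real k * real m ^ 3" ..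
  show ?thesis
  proof (rule that[OF S(1)])
    fix i assume i: "i \<in> {1..k}"
    have "Y i S \<le> (\<Sum>i\<in>{1..k}. Y i S)"
      using i by (intro member_le_sum) (auto simp: Y_def)
    then have "sqrt (Y i S) \<le> sqrt (real k * real m ^ 3)"
      using S(2) by (intro real_sqrt_le_mono) linarith
    then have "\<bar>real (card {e \<in> G i. e \<subseteq> S}) - \<mu> i\<bar> \<le> sqrt (real k * real m ^ 3)"
      by (simp only: Y_def real_sqrt_abs)
    then show "real (card (G i)) * (real (m choose 2) / real (card V choose 2))
        - sqrt (real k * real m ^ 3) \<le> real (card {e \<in> G i. e \<subseteq> S})"
      unfolding \<mu>_def by linarith
  qed
qed

section \<open>Relabelling the vertices of a restricted system\<close>

text \<open>A rainbow copy in the pulled-back system is carried by \<open>h\<close> to a rainbow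
  copy in \<open>G\<close> with the same colours; injectivity keeps the two ends of each edge
  distinct.\<close>

lemma rainbow_free_pullback:
  fixes H :: "('v, 'e) multigraph" and W :: "'w set"
  assumes free: "rainbow_free k V G H" and h: "inj_on h W" "h ` W \<subseteq> V"
  shows "rainbow_free k W (\<lambda>i. {e \<in> nsets W 2. h ` e \<in> G i}) H"
  unfolding rainbow_free_def
proof
  assume "\<exists>H' :: ('w, 'e) multigraph. rainbow_subgraph k W (\<lambda>i. {e \<in> nsets W 2. h ` e \<in> G i}) H' \<and> mg_isomorphic H H'"
  then obtain H' :: "('w, 'e) multigraph" where sub: "rainbow_subgraph k W (\<lambda>i. {e \<in> nsets W 2. h ` e \<in> G i}) H'"
    and iso: "mg_isomorphic H H'" by blast
  \<comment> \<open>The edge labels of \<open>H'\<close> are kept and only their ends are moved, so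
    the same \<open>\<psi>\<close> and the same edge bijection \<open>g\<close> serve for the
    image.\<close>
  define H'' where "H'' = \<lparr>mg_verts = h ` mg_verts H', mg_edges = mg_edges H',
    mg_ends = (\<lambda>e. h ` mg_ends H' e)\<rparr>"
  obtain \<psi> where H': "is_multigraph H'" "mg_verts H' \<subseteq> W"
    and \<psi>: "inj_on \<psi> (mg_edges H')" "\<psi> ` mg_edges H' \<subseteq> {1..k}"
      "\<forall>e \<in> mg_edges H'. h ` mg_ends H' e \<in> G (\<psi> e)"
    using sub by (auto simp: rainbow_subgraph_def)
  have injV: "inj_on h (mg_verts H')"
    using h(1) H'(2) by (rule inj_on_subset)
  have "h ` e \<in> nsets (h ` mg_verts H') 2" if "e \<in> nsets (mg_verts H') 2" for e
    using that card_image[OF inj_on_subset[OF injV, of e]] by (auto simp: nsets_def)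
  then have "is_multigraph H''"
    using H'(1) by (auto simp: is_multigraph_def H''_def)
  then have "rainbow_subgraph k V G H''"
    unfolding rainbow_subgraph_def
    using H'(2) h(2) \<psi> by (intro conjI exI[of _ \<psi>]) (auto simp: H''_def)
  moreover have "mg_isomorphic H H''"
  proof -
    obtain f g where fg: "bij_betw f (mg_verts H) (mg_verts H')" "bij_betw g (mg_edges H) (mg_edges H')"
      "\<forall>e \<in> mg_edges H. mg_ends H' (g e) = f ` mg_ends H e"
      using iso by (auto simp: mg_isomorphic_def)
    have "bij_betw (h \<circ> f) (mg_verts H) (h ` mg_verts H')"
      using fg(1) injV by (meson bij_betw_trans inj_on_imp_bij_betw)
    then show ?thesis
      unfolding mg_isomorphic_def H''_def using fg
      by (intro exI[of _ "h \<circ> f"] exI[of _ g]) (auto simp: image_comp)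
  qed
  ultimately show False using free by (auto simp: rainbow_free_def)
qed

text \<open>Taking images under \<open>h\<close> is a bijection between the two edge sets. This
  transfers the edge counts inside \<open>S\<close> to the relabelled system on
  \<open>W\<close>.\<close>

lemma card_pullback_edges:
  assumes h: "bij_betw h W S" and G: "G \<subseteq> nsets V 2"
  shows "card {e \<in> nsets W 2. h ` e \<in> G} = card {e \<in> G. e \<subseteq> S}"
proof (rule bij_betw_same_card)
  have inj: "inj_on h W" and img: "h ` W = S" using h by (auto simp: bij_betw_def)
  show "bij_betw ((`) h) {e \<in> nsets W 2. h ` e \<in> G} {e \<in> G. e \<subseteq> S}"
    unfolding bij_betw_def
  proof
    show "inj_on ((`) h) {e \<in> nsets W 2. h ` e \<in> G}"
      using inj_on_image_Pow[OF inj] by (rule inj_on_subset) (auto simp: nsets_def)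
    show "(`) h ` {e \<in> nsets W 2. h ` e \<in> G} = {e \<in> G. e \<subseteq> S}"
    proof (intro equalityI subsetI)
      fix e assume e: "e \<in> {e \<in> G. e \<subseteq> S}"
      then obtain d where d: "d \<subseteq> W" "e = h ` d" using img by (metis mem_Collect_eq subset_imageE)
      then have "inj_on h d" using inj inj_on_subset by blast
      then have "d \<in> nsets W 2"
        using d e G by (auto simp: nsets_def card_image finite_image_iff dest!: subsetD)
      then show "e \<in> (`) h ` {e \<in> nsets W 2. h ` e \<in> G}" using d e by blast
    qed (use img in \<open>auto simp: nsets_def\<close>)
  qed
qed

section \<open>Almost monotone densities and convergence\<close>

text \<open>An extremal system on \<open>N\<close> vertices is restricted to a set \<open>S\<close>
  that is dense for all its graphs and relabelled as a system on \<open>{1..m}\<close>, which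
  competes in the maximum defining \<open>rainbow_ex k m H\<close>.\<close>

lemma rainbow_ex_density_le:
  fixes H :: "('v, 'e) multigraph"
  assumes "mg_edges H \<noteq> {}" "1 \<le> k" "2 \<le> m" "m \<le> N"
  shows "real (rainbow_ex k N H) / real (N choose 2) \<le>
    real (rainbow_ex k m H) / real (m choose 2) + sqrt (real k * real m ^ 3) / real (m choose 2)"
proof -
  have "rainbow_ex k N H \<in> rainbow_ex_values k N H"
    unfolding rainbow_ex_def
    using assms by (intro Max_in finite_rainbow_ex_values rainbow_ex_values_nonempty)
  then obtain G where G: "graph_system k {1..N} G" "rainbow_free k {1..N} G H"
    and exN: "rainbow_ex k N H = Min ((\<lambda>i. card (G i)) ` {1..k})"
    by (auto simp: rainbow_ex_values_def)
  obtain S where S: "S \<in> nsets {1..N} m" and dense: "\<And>i. i \<in> {1..k} \<Longrightarrow>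
      real (card (G i)) * (real (m choose 2) / real (N choose 2)) - sqrt (real k * real m ^ 3)
        \<le> real (card {e \<in> G i. e \<subseteq> S})"
    using graph_system_dense_subset[OF _ G(1), of m] assms by auto
  obtain h where h: "bij_betw h {1..m} S"
    using S by (auto simp: nsets_def intro: finite_same_card_bij[of "{1..m}" S, THEN exE])
  define G' where "G' i = {e \<in> nsets {1..m} 2. h ` e \<in> G i}" for i
  have "rainbow_free k {1..m} G' H"
    unfolding G'_def using h S
    by (intro rainbow_free_pullback[OF G(2)]) (auto simp: bij_betw_def nsets_def)
  moreover have "graph_system k {1..m} G'" by (auto simp: graph_system_def G'_def)
  ultimately have "Min ((\<lambda>i. card (G' i)) ` {1..k}) \<in> rainbow_ex_values k m H"
    by (auto simp: rainbow_ex_values_def)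
  then have exm: "Min ((\<lambda>i. card (G' i)) ` {1..k}) \<le> rainbow_ex k m H"
    unfolding rainbow_ex_def by (intro Max_ge finite_rainbow_ex_values)
  \<comment> \<open>The index \<open>i\<close> is a minimiser of the restricted system, not of the
    original one: \<open>rainbow_ex k N H \<le> card (G i)\<close> holds for every index, whereas
    the upper bound on \<open>card (G' i)\<close> requires a minimiser.\<close>
  have "Min ((\<lambda>i. card (G' i)) ` {1..k}) \<in> (\<lambda>i. card (G' i)) ` {1..k}"
    using assms by (intro Min_in) auto
  then obtain i where i: "i \<in> {1..k}" "card (G' i) \<le> rainbow_ex k m H"
    using exm by auto
  have cardi: "card (G' i) = card {e \<in> G i. e \<subseteq> S}"
    unfolding G'_def using G(1) i
    by (intro card_pullback_edges[OF h]) (auto simp: graph_system_def)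
  have "rainbow_ex k N H \<le> card (G i)"
    unfolding exN using i by (intro Min_le) auto
  then have "real (rainbow_ex k N H) * (real (m choose 2) / real (N choose 2)) \<le>
      real (card (G i)) * (real (m choose 2) / real (N choose 2))"
    by (intro mult_right_mono) auto
  then have "real (rainbow_ex k N H) * (real (m choose 2) / real (N choose 2)) \<le>
      real (rainbow_ex k m H) + sqrt (real k * real m ^ 3)"
    using dense[OF i(1)] i(2) cardi by linarith
  moreover have "real (m choose 2) > 0" using assms by (simp add: zero_less_binomial)
  ultimately show ?thesis by (simp add: field_simps)
qed

text \<open>The limit is the infimum \<open>L\<close> of \<open>a m + \<delta> m\<close>. Each term
  satisfies \<open>L - \<delta> n \<le> a n\<close>, and a single \<open>m\<close> with
  \<open>a m + \<delta> m < y\<close> keeps all later terms below \<open>y\<close>.\<close>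

lemma convergent_almost_decreasing:
  fixes a \<delta> :: "nat \<Rightarrow> real"
  assumes le: "\<And>m n. m0 \<le> m \<Longrightarrow> m \<le> n \<Longrightarrow> a n \<le> a m + \<delta> m"
    and nonneg: "\<And>n. 0 \<le> a n" "\<And>n. 0 \<le> \<delta> n" and lim: "\<delta> \<longlonglongrightarrow> 0"
  shows "convergent a"
proof -
  define L where "L = (INF m\<in>{m0..}. a m + \<delta> m)"
  have bdd: "bdd_below ((\<lambda>m. a m + \<delta> m) ` {m0..})"
    using nonneg by (intro bdd_belowI[of _ 0]) auto
  have lower: "L - \<delta> n \<le> a n" if "m0 \<le> n" for n
    using cINF_lower[OF bdd, of n] that by (simp add: L_def)
  have "(\<lambda>n. L - \<delta> n) \<longlonglongrightarrow> L - 0"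
    by (intro tendsto_intros lim)
  then have limL: "(\<lambda>n. L - \<delta> n) \<longlonglongrightarrow> L" by simp
  have "a \<longlonglongrightarrow> L"
  proof (rule order_tendstoI)
    fix y assume "y < L"
    then have "\<forall>\<^sub>F n in sequentially. y < L - \<delta> n"
      using limL by (simp add: order_tendsto_iff)
    then show "\<forall>\<^sub>F n in sequentially. y < a n"
      using eventually_ge_at_top[of m0] by eventually_elim (use lower in force)
  next
    fix y assume "L < y"
    then obtain m where "m0 \<le> m" "a m + \<delta> m < y"
      using cINF_less_iff[OF _ bdd] by (auto simp: L_def)
    then show "\<forall>\<^sub>F n in sequentially. a n < y"
      using le by (intro eventually_sequentiallyI[of m]) (meson le_less_trans)
  qed
  then show ?thesis by (rule convergentI)
qed

text \<open>Once there is room for the vertices, every system contains a copy of an edgeless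
  \<open>H\<close>, with the empty colouring; hence no system is rainbow free.\<close>

lemma rainbow_ex_values_edgeless:
  fixes H :: "('v, 'e) multigraph"
  assumes "is_multigraph H" "mg_edges H = {}" "card (mg_verts H) \<le> n"
  shows "rainbow_ex_values k n H = {}"
proof -
  obtain f where f: "bij_betw f (mg_verts H) {1..card (mg_verts H)}"
    using assms finite_same_card_bij[of "mg_verts H" "{1..card (mg_verts H)}"]
    by (auto simp: is_multigraph_def)
  define H' :: "(nat, 'e) multigraph"
    where "H' = \<lparr>mg_verts = {1..card (mg_verts H)}, mg_edges = {}, mg_ends = (\<lambda>_. {})\<rparr>"
  have "rainbow_subgraph k {1..n} G H'" for G
    using assms by (auto simp: rainbow_subgraph_def is_multigraph_def H'_def)
  moreover have "mg_isomorphic H H'"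
    using f assms by (auto simp: mg_isomorphic_def H'_def bij_betw_def)
  ultimately have "\<not> rainbow_free k {1..n} G H" for G
    by (auto simp: rainbow_free_def)
  then show ?thesis by (simp add: rainbow_ex_values_def)
qed

theorem theorem1p1:
  fixes H :: "('v, 'e) multigraph" and k :: nat
  assumes "is_multigraph H"
    and "k \<ge> card (mg_edges H)"
  shows "convergent (\<lambda>n. real (rainbow_ex k n H) / real (n choose 2))"
proof (cases "mg_edges H = {}")
  case True
  \<comment> \<open>For large \<open>n\<close> the maximum is the unspecified \<open>Max {}\<close>,
    which does not vary with \<open>n\<close>, so the quotient tends to 0 whatever this value
    is.\<close>
  define c where "c = real (Max ({} :: nat set))"
  have "\<forall>\<^sub>F n in sequentially. real (rainbow_ex k n H) / real (n choose 2) = c / real (n choose 2)"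
    using rainbow_ex_values_edgeless[OF assms(1) True]
    by (intro eventually_sequentiallyI[of "card (mg_verts H)"]) (simp add: rainbow_ex_def c_def)
  moreover have "(\<lambda>n. c / real (n choose 2)) \<longlonglongrightarrow> 0"
  proof -
    have "(\<lambda>n. 1 / (real n * (real n - 1) / 2)) \<longlonglongrightarrow> 0"
      by real_asymp
    then have "(\<lambda>n. c * (1 / (real n * (real n - 1) / 2))) \<longlonglongrightarrow> 0"
      by (rule tendsto_mult_right_zero)
    then show ?thesis by (simp add: of_nat_choose_two)
  qed
  ultimately have "(\<lambda>n. real (rainbow_ex k n H) / real (n choose 2)) \<longlonglongrightarrow> 0"
    by (rule tendsto_cong[THEN iffD2])
  then show ?thesis by (rule convergentI)
next
  case False
  then have "card (mg_edges H) > 0"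
    using assms by (simp add: is_multigraph_def card_gt_0_iff)
  then have k: "1 \<le> k" using assms by linarith
  \<comment> \<open>The error is of order m^(3/2) / m^2, that is m^(-1/2); the constant
    \<open>sqrt (real k)\<close> is split off first.\<close>
  have "(\<lambda>m. sqrt (real m ^ 3) / (real m * (real m - 1) / 2)) \<longlonglongrightarrow> 0"
    by real_asymp
  then have "(\<lambda>m. sqrt (real k) * (sqrt (real m ^ 3) / (real m * (real m - 1) / 2))) \<longlonglongrightarrow> 0"
    by (rule tendsto_mult_right_zero)
  then have lim: "(\<lambda>m. sqrt (real k * real m ^ 3) / real (m choose 2)) \<longlonglongrightarrow> 0"
    by (simp add: of_nat_choose_two real_sqrt_mult mult.assoc)
  show ?thesis
    using rainbow_ex_density_le[OF False k]
    by (rule convergent_almost_decreasing[OF _ _ _ lim]) simp_all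
qed

end
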